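(* Let $A\in\mathbb{R}^{n\times n}$ be nonsingular with $\|A^{-1}\|_1<1/2$ and let $b\in\mathbb{R}^n$. A sign vector $z^*\in\{-1,1\}^n$ is a global maximizer over $\{-1,1\}^n$ of $F(z)=z^T(A-\operatorname{Diag}(z))^{-1}b$ if and only if the associated primal vector $x^*=(A-\operatorname{Diag}(z^* ))^{-1}b$ solves the absolute value equation $Ax-|x|=b$.
   Context: $|x|$ is taken componentwise. $\|\cdot\|_1$ for matrices is the maximum absolute column sum. $\operatorname{Diag}(z)$ is the diagonal matrix with diagonal $z$. Under the stated condition, $A-\operatorname{Diag}(z)$ is nonsingular for every $z\in\{-1,1\}^n$, so $F$ is well defined on $\{-1,1\}^n$. *)

theory Defs
  imports "HOL-Analysis.Analysis"
begin

(* On real ^ 'n the library's absolute value is componentwise (abs_vec_def). *)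

definition Diag :: "real ^ 'n \<Rightarrow> real ^ 'n ^ 'n" where
  "Diag z = (\<chi> i j. if i = j then z $ i else 0)"

(* A $ i $ j is row i, column j, so the inner sum runs down the j-th column. *)
definition matrix_norm1 :: "real ^ 'n ^ 'm \<Rightarrow> real" where
  "matrix_norm1 A = Max (range (\<lambda>j. \<Sum>i\<in>UNIV. \<bar>A $ i $ j\<bar>))"

definition sign_vectors :: "(real ^ 'n) set" where
  "sign_vectors = {z. \<forall>i. z $ i \<in> {-1, 1}}"

(* matrix_inv is the true inverse only for invertible matrices. If A is invertible and
   matrix_norm1 (matrix_inv A) < 1/2, then A - Diag z is invertible for every sign vector z. *)
definition primal_vector :: "real ^ 'n ^ 'n \<Rightarrow> real ^ 'n \<Rightarrow> real ^ 'n \<Rightarrow> real ^ 'n" where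
  "primal_vector A b z = matrix_inv (A - Diag z) *v b"

definition F :: "real ^ 'n ^ 'n \<Rightarrow> real ^ 'n \<Rightarrow> real ^ 'n \<Rightarrow> real" where
  "F A b z = z \<bullet> (matrix_inv (A - Diag z) *v b)"

definition solves_AVE :: "real ^ 'n ^ 'n \<Rightarrow> real ^ 'n \<Rightarrow> real ^ 'n \<Rightarrow> bool" where
  "solves_AVE A b x \<longleftrightarrow> A *v x - \<bar>x\<bar> = b"

end

theory Submission
  imports Defs
begin

text \<open>
  Put \<open>M = A\<^sup>-\<^sup>1\<close>, \<open>q = \<parallel>M\<parallel>\<^sub>1 < 1/2\<close>, and for sign vectors \<open>z, z'\<close> with primal vectors \<open>x, x'\<close> let
  \<open>w = z' x' - z x\<close> (componentwise products), so that \<open>F z' - F z = \<Sum>\<^sub>i w\<^sub>i\<close>. From \<open>A x - z x = b\<close> one gets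
  \<open>x' - x = M w\<close> and hence \<open>w = z' (M w) + (z' - z) x\<close>. If \<open>d = (z' - z) x\<close> has constant sign, this is
  a perturbation of \<open>d\<close> small enough for \<open>\<Sum>\<^sub>i w\<^sub>i\<close> to have the sign of \<open>\<Sum>\<^sub>i d\<^sub>i\<close>. If \<open>x\<close> solves the
  equation then \<open>z x = \<bar>x\<bar>\<close> and \<open>d \<le> 0\<close> for every \<open>z'\<close>; otherwise the signs \<open>z'\<close> of \<open>x\<close> give
  \<open>d = \<bar>x\<bar> - z x \<ge> 0\<close>, \<open>d \<noteq> 0\<close>, so that \<open>F\<close> increases.
\<close>

lemma Diag_mult_vec: "Diag z *v x = z * x"
  by (simp add: vec_eq_iff Diag_def matrix_vector_mult_def if_distrib[where f="\<lambda>t. t * _"] cong: if_cong)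

lemma abs_sign_vector_nth:
  assumes "z \<in> sign_vectors"
  shows "\<bar>z $ i\<bar> = 1"
proof -
  have "z $ i \<in> {-1, 1}"
    using assms by (simp add: sign_vectors_def)
  then show ?thesis
    by auto
qed

lemma sign_vector_mult_le_abs:
  assumes "z \<in> sign_vectors"
  shows "z $ i * t \<le> \<bar>t\<bar>"
  using abs_ge_self[of "z $ i * t"] by (simp add: abs_mult abs_sign_vector_nth[OF assms])

text \<open>The maximum column sum dominates the operator norm on l1: after swapping the sums, each
  \<open>\<bar>v $ j\<bar>\<close> is weighted by the j-th absolute column sum.\<close>

lemma sum_abs_matrix_vector_mult_le:
  fixes M :: "real ^ 'n ^ 'm"
  shows "(\<Sum>i\<in>UNIV. \<bar>(M *v v) $ i\<bar>) \<le> matrix_norm1 M * (\<Sum>j\<in>UNIV. \<bar>v $ j\<bar>)"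
proof -
  have "(\<Sum>i\<in>UNIV. \<bar>(M *v v) $ i\<bar>) \<le> (\<Sum>i\<in>UNIV. \<Sum>j\<in>UNIV. \<bar>M $ i $ j\<bar> * \<bar>v $ j\<bar>)"
    by (intro sum_mono) (simp add: matrix_vector_mult_def flip: abs_mult)
  also have "\<dots> = (\<Sum>j\<in>UNIV. (\<Sum>i\<in>UNIV. \<bar>M $ i $ j\<bar>) * \<bar>v $ j\<bar>)"
    by (subst sum.swap) (simp add: sum_distrib_right)
  also have "\<dots> \<le> (\<Sum>j\<in>UNIV. matrix_norm1 M * \<bar>v $ j\<bar>)"
    by (intro sum_mono mult_right_mono) (auto simp: matrix_norm1_def)
  finally show ?thesis
    by (simp add: sum_distrib_left)
qed

lemma matrix_inv_vector_mult_cancel: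
  fixes A :: "real ^ 'n ^ 'n"
  assumes "invertible A"
  shows "matrix_inv A *v (A *v x) = x" and "A *v (matrix_inv A *v x) = x"
proof -
  have "A ** matrix_inv A = mat 1 \<and> matrix_inv A ** A = mat 1"
    using assms unfolding invertible_def matrix_inv_def by (rule someI_ex)
  then show "matrix_inv A *v (A *v x) = x" and "A *v (matrix_inv A *v x) = x"
    by (simp_all add: matrix_vector_mul_assoc)
qed

text \<open>A kernel vector \<open>v\<close> is a fixed point of
  \<open>v \<mapsto> matrix_inv A *v (z * v)\<close>. Multiplication by \<open>z\<close> preserves
  the l1 norm and \<open>matrix_inv A\<close> contracts it strictly, so
  \<open>v = 0\<close>.\<close>

lemma invertible_diff_Diag:
  fixes A :: "real ^ 'n ^ 'n"
  assumes A: "invertible A" and q: "matrix_norm1 (matrix_inv A) < 1" and z: "z \<in> sign_vectors"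
  shows "invertible (A - Diag z)"
proof -
  have "v = 0" if "(A - Diag z) *v v = 0" for v
  proof -
    let ?s = "\<Sum>i\<in>UNIV. \<bar>v $ i\<bar>"
    have "A *v v = z * v"
      using that by (simp add: matrix_vector_mult_diff_rdistrib Diag_mult_vec)
    then have "v = matrix_inv A *v (z * v)"
      by (metis matrix_inv_vector_mult_cancel(1)[OF A])
    then have "?s \<le> matrix_norm1 (matrix_inv A) * ?s"
      using sum_abs_matrix_vector_mult_le[of "matrix_inv A" "z * v"]
      by (simp add: abs_mult abs_sign_vector_nth[OF z])
    moreover have "0 \<le> ?s"
      by (simp add: sum_nonneg)
    ultimately have "?s = 0"
      using q by (smt (verit) mult_le_cancel_right1)
    then show ?thesis
      by (simp add: sum_nonneg_eq_0_iff vec_eq_iff)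
  qed
  then show ?thesis
    by (simp add: invertible_left_inverse matrix_left_invertible_ker)
qed

lemma primal_vector_eq:
  assumes "invertible (A - Diag z)"
  shows "A *v primal_vector A b z - z * primal_vector A b z = b"
  using matrix_inv_vector_mult_cancel(2)[OF assms, of b]
  by (simp add: primal_vector_def matrix_vector_mult_diff_rdistrib Diag_mult_vec)

text \<open>Let \<open>q = matrix_norm1 M\<close>, and let \<open>m\<close>, \<open>D\<close> be the
  l1 norms of \<open>M *v w\<close> and \<open>d\<close>. The l1 norm of \<open>w\<close> is at most
  \<open>m + D\<close>, so \<open>m \<le> q * (m + D)\<close>, that is
  \<open>(1 - q) * m \<le> q * D\<close>. Since the entries of \<open>w\<close> sum to at least
  \<open>D - m\<close>, multiplying by \<open>1 - q\<close> leaves the factor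
  \<open>1 - 2 * q\<close>, the source of the bound 1/2.\<close>

lemma sum_perturbed_ge:
  fixes M :: "real ^ 'n ^ 'n"
  assumes q: "matrix_norm1 M < 1" and z: "z \<in> sign_vectors"
    and w: "w = z * (M *v w) + d" and d: "\<And>i. 0 \<le> d $ i"
  shows "(1 - 2 * matrix_norm1 M) * (\<Sum>i\<in>UNIV. d $ i)
    \<le> (1 - matrix_norm1 M) * (\<Sum>i\<in>UNIV. w $ i)"
proof -
  let ?q = "matrix_norm1 M" and ?W = "\<Sum>i\<in>UNIV. \<bar>w $ i\<bar>"
    and ?d = "\<Sum>i\<in>UNIV. d $ i" and ?m = "\<Sum>i\<in>UNIV. \<bar>(M *v w) $ i\<bar>"
  have wi: "w $ i = z $ i * (M *v w) $ i + d $ i" for i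
    by (subst w) simp
  have zM: "\<bar>z $ i * (M *v w) $ i\<bar> = \<bar>(M *v w) $ i\<bar>" for i
    by (simp add: abs_mult abs_sign_vector_nth[OF z])
  have "\<bar>w $ i\<bar> \<le> \<bar>(M *v w) $ i\<bar> + d $ i" and "d $ i - \<bar>(M *v w) $ i\<bar> \<le> w $ i" for i
    using wi[of i] zM[of i] d[of i] by linarith+
  then have "?W \<le> (\<Sum>i\<in>UNIV. \<bar>(M *v w) $ i\<bar> + d $ i)"
    and "(\<Sum>i\<in>UNIV. d $ i - \<bar>(M *v w) $ i\<bar>) \<le> (\<Sum>i\<in>UNIV. w $ i)"
    by (auto intro: sum_mono)
  then have W: "?W \<le> ?m + ?d" and S: "?d - ?m \<le> (\<Sum>i\<in>UNIV. w $ i)"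
    by (simp_all add: sum.distrib sum_subtractf)
  have m: "?m \<le> ?q * ?W"
    by (rule sum_abs_matrix_vector_mult_le)
  have "0 \<le> ?q"
    unfolding matrix_norm1_def by (subst Max_ge_iff) (auto intro: sum_nonneg)
  then have "?q * ?W \<le> ?q * (?m + ?d)"
    using W by (rule mult_left_mono[rotated])
  with m have "(1 - ?q) * ?m \<le> ?q * ?d"
    by (simp add: algebra_simps)
  moreover have "(1 - ?q) * (?d - ?m) \<le> (1 - ?q) * (\<Sum>i\<in>UNIV. w $ i)"
    using S q by (intro mult_left_mono) auto
  ultimately show ?thesis
    by (simp add: algebra_simps)
qed

lemma F_eq_sum: "F A b z = (\<Sum>i\<in>UNIV. (z * primal_vector A b z) $ i)"
  by (simp add: F_def primal_vector_def inner_vec_def)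

text \<open>This brings the change of \<open>F\<close> into the form that
  \<open>sum_perturbed_ge\<close> expects, with \<open>d = (z' - z) * x\<close>. The two linear
  systems share the right-hand side \<open>b\<close>, so it cancels.\<close>

lemma scaled_primal_vector_diff:
  fixes A :: "real ^ 'n ^ 'n" and b :: "real ^ 'n"
  assumes A: "invertible A" and q: "matrix_norm1 (matrix_inv A) < 1"
    and z: "z \<in> sign_vectors" and z': "z' \<in> sign_vectors"
  defines "w \<equiv> z' * primal_vector A b z' - z * primal_vector A b z"
  shows "w = z' * (matrix_inv A *v w) + (z' - z) * primal_vector A b z"
proof -
  let ?x = "primal_vector A b z" and ?x' = "primal_vector A b z'"
  have "A *v ?x - z * ?x = A *v ?x' - z' * ?x'"
    using primal_vector_eq[OF invertible_diff_Diag[OF A q z]]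
      primal_vector_eq[OF invertible_diff_Diag[OF A q z']] by metis
  then have "A *v (?x' - ?x) = w"
    by (simp add: w_def matrix_vector_mult_diff_distrib algebra_simps)
  then have "matrix_inv A *v w = ?x' - ?x"
    by (metis matrix_inv_vector_mult_cancel(1)[OF A])
  moreover have "w = z' * (?x' - ?x) + (z' - z) * ?x"
    by (simp add: w_def algebra_simps)
  ultimately show ?thesis
    by simp
qed

text \<open>As \<open>A *v x - z * x = b\<close> holds already, only the terms \<open>z * x\<close>
  and \<open>\<bar>x\<bar>\<close> remain to be compared.\<close>

lemma solves_AVE_primal_vector_iff:
  assumes "invertible (A - Diag z)"
  shows "solves_AVE A b (primal_vector A b z)
    \<longleftrightarrow> (\<forall>i. z $ i * primal_vector A b z $ i = \<bar>primal_vector A b z $ i\<bar>)"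
proof -
  let ?x = "primal_vector A b z"
  have "solves_AVE A b ?x \<longleftrightarrow> A *v ?x - \<bar>?x\<bar> = A *v ?x - z * ?x"
    by (simp add: solves_AVE_def primal_vector_eq[OF assms])
  also have "\<dots> \<longleftrightarrow> z * ?x = \<bar>?x\<bar>"
    by (metis diff_left_imp_eq)
  finally show ?thesis
    by (simp add: vec_eq_iff abs_vec_def)
qed

theorem theorem2p3:
  fixes A :: "real ^ 'n ^ 'n" and b z_star :: "real ^ 'n"
  assumes "invertible A"
    and "matrix_norm1 (matrix_inv A) < 1 / 2"
    and "z_star \<in> sign_vectors"
  shows "is_arg_max (F A b) (\<lambda>z. z \<in> sign_vectors) z_star
    \<longleftrightarrow> solves_AVE A b (primal_vector A b z_star)"
proof -
  let ?M = "matrix_inv A" and ?z = z_star and ?x = "primal_vector A b z_star"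
  define w where "w z' = z' * primal_vector A b z' - ?z * ?x" for z'
  have q: "matrix_norm1 ?M < 1"
    using assms(2) by simp
  have w: "w z' = z' * (?M *v w z') + (z' - ?z) * ?x" if "z' \<in> sign_vectors" for z'
    unfolding w_def by (rule scaled_primal_vector_diff[OF assms(1) q assms(3) that])
  have F: "F A b z' - F A b ?z = (\<Sum>i\<in>UNIV. w z' $ i)" for z'
    by (simp add: F_eq_sum w_def sum_subtractf)
  have solves_iff: "solves_AVE A b ?x \<longleftrightarrow> (\<forall>i. ?z $ i * ?x $ i = \<bar>?x $ i\<bar>)"
    by (rule solves_AVE_primal_vector_iff[OF invertible_diff_Diag[OF assms(1) q assms(3)]])
  show ?thesis
  proof
    assume "solves_AVE A b ?x"
    then have x: "?z $ i * ?x $ i = \<bar>?x $ i\<bar>" for i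
      by (simp add: solves_iff)
    have "F A b z' \<le> F A b ?z" if z': "z' \<in> sign_vectors" for z'
    proof -
      let ?d = "(?z - z') * ?x"
      have d: "0 \<le> ?d $ i" for i
        using sign_vector_mult_le_abs[OF z', of i "?x $ i"] x[of i] by (simp add: algebra_simps)
      \<comment> \<open>Here \<open>(z' - ?z) * ?x\<close> is nonpositive, so the recursion is
        negated before \<open>sum_perturbed_ge\<close> is applied.\<close>
      have "- w z' = z' * (?M *v (- w z')) + ?d"
        using arg_cong[OF w[OF z'], of uminus]
        by (simp add: algebra_simps linear_neg[OF matrix_vector_mul_linear])
      from sum_perturbed_ge[OF q z' this d]
      have "(1 - 2 * matrix_norm1 ?M) * (\<Sum>i\<in>UNIV. ?d $ i)
          \<le> (1 - matrix_norm1 ?M) * (F A b ?z - F A b z')"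
        using F[of z'] by (simp add: sum_negf algebra_simps)
      moreover have "0 \<le> (1 - 2 * matrix_norm1 ?M) * (\<Sum>i\<in>UNIV. ?d $ i)"
        using assms(2) by (intro mult_nonneg_nonneg sum_nonneg d) simp
      ultimately have "0 \<le> (1 - matrix_norm1 ?M) * (F A b ?z - F A b z')"
        by linarith
      then show ?thesis
        using q by (simp add: zero_le_mult_iff)
    qed
    then show "is_arg_max (F A b) (\<lambda>z. z \<in> sign_vectors) ?z"
      using assms(3) by (auto simp: is_arg_max_def not_less)
  next
    assume max: "is_arg_max (F A b) (\<lambda>z. z \<in> sign_vectors) ?z"
    \<comment> \<open>At a zero entry of \<open>?x\<close> either sign would do, since the product
      with \<open>?x\<close> vanishes there.\<close>
    define z' :: "real ^ 'n" where "z' = (\<chi> i. if 0 \<le> ?x $ i then 1 else -1)"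
    let ?d = "(z' - ?z) * ?x"
    have z': "z' \<in> sign_vectors"
      by (simp add: z'_def sign_vectors_def)
    have di: "?d $ i = \<bar>?x $ i\<bar> - ?z $ i * ?x $ i" for i
      by (simp add: z'_def algebra_simps)
    have d: "0 \<le> ?d $ i" for i
      unfolding di using sign_vector_mult_le_abs[OF assms(3), of i "?x $ i"] by linarith
    have "(1 - 2 * matrix_norm1 ?M) * (\<Sum>i\<in>UNIV. ?d $ i)
        \<le> (1 - matrix_norm1 ?M) * (F A b z' - F A b ?z)"
      unfolding F by (rule sum_perturbed_ge[OF q z' w[OF z'] d])
    also have "\<dots> \<le> 0"
      using max z' q by (intro mult_nonneg_nonpos) (auto simp: is_arg_max_def not_less)
    \<comment> \<open>The factor \<open>1 - 2 * matrix_norm1 ?M\<close> is strictly positive and can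
      be divided out; nonnegative entries with sum at most 0 all vanish.\<close>
    finally have "(\<Sum>i\<in>UNIV. ?d $ i) \<le> 0"
      using assms(2) by (simp add: mult_le_0_iff)
    then have "(\<Sum>i\<in>UNIV. ?d $ i) = 0"
      using sum_nonneg[of UNIV "\<lambda>i. ?d $ i"] d by fastforce
    then have "?d $ i = 0" for i
      using d sum_nonneg_eq_0_iff[of UNIV "\<lambda>i. ?d $ i"] by simp
    then show "solves_AVE A b ?x"
      unfolding solves_iff di by simp
  qed
qed

end
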